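(* Let $d\ge4$ be an integer. Let $A=D_AP_A$ and $B=D_BP_B$, where $D_A=\operatorname{diag}(a_1,\dots,a_d)$ and $D_B=\operatorname{diag}(b_1,\dots,b_d)$ are complex diagonal matrices, and $P_A,P_B$ are $d\times d$ permutation matrices all of whose diagonal entries are zero. Suppose that $\sum_{i=1}^d(|a_i|^2+|b_i|^2)=\frac1d$ and that $\operatorname{rank}A=1$. Let $X=A\otimes I_d+I_d\otimes B$ and let $\sigma_1\ge\sigma_2\ge\cdots\ge\sigma_{d^2}$ be the singular values of $X$. Then $\sigma_1^2+\sigma_2^2\le\frac12$.
   Context: $\otimes$ denotes the Kronecker product and $I_d$ the $d\times d$ identity matrix. Singular values are counted with multiplicity. *)

theory Defs
  imports
    Complex_Main
    "Jordan_Normal_Form.Schur_Decomposition"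
    "Jordan_Normal_Form.DL_Rank"
begin

definition permutation_mat :: "nat \<Rightarrow> 'a::{zero,one} mat \<Rightarrow> bool" where
  "permutation_mat n P \<longleftrightarrow>
     (\<exists>p. p permutes {..<n} \<and> P = mat n n (\<lambda>(i, j). if j = p i then 1 else 0))"

definition kronecker :: "'a::times mat \<Rightarrow> 'a mat \<Rightarrow> 'a mat" (infixl \<open>\<otimes>\<^sub>K\<close> 70) where
  "A \<otimes>\<^sub>K B = mat (dim_row A * dim_row B) (dim_col A * dim_col B)
     (\<lambda>(i, j). A $$ (i div dim_row B, j div dim_col B) * B $$ (i mod dim_row B, j mod dim_col B))"

text \<open>
  The singular values of a square matrix \<open>X\<close> are the square roots of the eigenvalues of
  \<open>X\<^sup>* X\<close>, with multiplicity, here listed in decreasing order. As \<open>X\<^sup>* X\<close> is Hermitian and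
  positive semidefinite, its eigenvalues are nonnegative reals, so that taking \<open>Re\<close> loses
  nothing, and algebraic and geometric multiplicities agree.
\<close>

definition singular_values :: "complex mat \<Rightarrow> real list" where
  "singular_values X =
     rev (sorted_list_of_multiset
       (image_mset (\<lambda>e. sqrt (Re e)) (proots (char_poly (mat_adjoint X * X)))))"

lemma sorted_singular_values: "sorted_wrt (\<ge>) (singular_values X)"
  by (simp add: singular_values_def sorted_wrt_rev)

lemma length_singular_values:
  assumes "X \<in> carrier_mat n n"
  shows "length (singular_values X) = n"
proof -
  have "mat_adjoint X * X \<in> carrier_mat n n"
    using assms by (auto simp: mat_adjoint_def mat_of_rows_def cols_def)
  then have "size (proots (char_poly (mat_adjoint X * X))) = n"
    by (simp add: size_proots_complex degree_monic_char_poly)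
  then show ?thesis
    unfolding singular_values_def
    by (metis length_rev mset_sorted_list_of_multiset size_image_mset size_mset)
qed

end

theory Submission
  imports Defs
begin

text \<open>
  In fact every singular value satisfies \<open>\<sigma>\<^sup>2 \<le> 1 / d\<close>. Rank one leaves a single nonzero entry \<open>\<alpha>\<close>
  in \<open>A\<close>, at an off-diagonal position \<open>(k, l)\<close>, so \<open>X\<close> acts on a vector with blocks \<open>f\<^sub>0, \<dots>, f\<^sub>d\<^sub>-\<^sub>1\<close>
  by \<open>f\<^sub>i \<mapsto> B f\<^sub>i\<close> for \<open>i \<noteq> k\<close> and \<open>f\<^sub>k \<mapsto> \<alpha> f\<^sub>l + B f\<^sub>k\<close>. Cauchy--Schwarz applied to each coordinate of
  block \<open>k\<close> costs the additional terms \<open>\<bar>b\<^sub>j\<bar>\<^sup>2 \<bar>f\<^sub>l\<^sub>j\<bar>\<^sup>2\<close>; together with the terms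
  \<open>\<bar>b\<^sub>j\<bar>\<^sup>2 \<bar>f\<^sub>l\<^sub>,\<^sub>q\<^sub>(\<^sub>j\<^sub>)\<bar>\<^sup>2\<close> of block \<open>l\<close> they are bounded by \<open>\<bar>b\<^sub>j\<bar>\<^sup>2 \<parallel>f\<^sub>l\<parallel>\<^sup>2\<close>, because \<open>q(j) \<noteq> j\<close>.
\<close>

text \<open>Pairing the eigenvalue equation with \<open>v\<close> gives two expressions for the
  inner product of \<open>v\<close> with X* X v, and moving the adjoint across turns one of them
  into the squared norm of \<open>X *\<^sub>v v\<close>. The identity stays complex because
  \<open>e\<close> is not yet known to be real.\<close>

lemma eigenvalue_adjoint_mult:
  fixes X :: "complex mat"
  assumes X: "X \<in> carrier_mat n n"
    and v: "v \<in> carrier_vec n"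
    and eig: "(mat_adjoint X * X) *\<^sub>v v = e \<cdot>\<^sub>v v"
  shows "e * complex_of_real (\<Sum>i<n. (cmod (v $ i))\<^sup>2) =
    complex_of_real (\<Sum>i<n. (cmod ((X *\<^sub>v v) $ i))\<^sup>2)"
proof -
  define w where "w = X *\<^sub>v v"
  have w: "w \<in> carrier_vec n" using X v by (auto simp: w_def)
  have adj: "mat_adjoint X \<in> carrier_mat n n"
    using X by (auto simp: mat_adjoint_def mat_of_rows_def cols_def)
  have w_nth: "w $ r = (\<Sum>i<n. X $$ (r, i) * v $ i)" if "r < n" for r
    using that X v by (auto simp: w_def scalar_prod_def atLeast0LessThan)
  have adj_nth: "(mat_adjoint X *\<^sub>v w) $ i = (\<Sum>r<n. cnj (X $$ (r, i)) * w $ r)" if "i < n" for i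
    using that X w adj
    by (auto simp: scalar_prod_def atLeast0LessThan mat_adjoint_def mat_of_rows_def intro!: sum.cong)
  have e_nth: "e * v $ i = (mat_adjoint X *\<^sub>v w) $ i" if "i < n" for i
  proof -
    have "mat_adjoint X *\<^sub>v w = e \<cdot>\<^sub>v v"
      using eig assoc_mult_mat_vec[OF adj X v] by (simp add: w_def)
    then show ?thesis using that v by simp
  qed
  have "e * complex_of_real (\<Sum>i<n. (cmod (v $ i))\<^sup>2) = (\<Sum>i<n. cnj (v $ i) * (e * v $ i))"
    by (simp add: sum_distrib_left complex_norm_square ac_simps del: of_real_power)
  also have "\<dots> = (\<Sum>i<n. \<Sum>r<n. cnj (v $ i) * (cnj (X $$ (r, i)) * w $ r))"
    by (simp add: e_nth adj_nth sum_distrib_left)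
  also have "\<dots> = (\<Sum>r<n. \<Sum>i<n. cnj (v $ i) * (cnj (X $$ (r, i)) * w $ r))"
    by (rule sum.swap)
  also have "\<dots> = (\<Sum>r<n. cnj (w $ r) * w $ r)"
    by (simp add: w_nth sum_distrib_left sum_distrib_right ac_simps)
  also have "\<dots> = complex_of_real (\<Sum>r<n. (cmod (w $ r))\<^sup>2)"
    by (simp add: complex_norm_square ac_simps del: of_real_power)
  finally show ?thesis by (simp add: w_def)
qed

text \<open>Reduces the theorem to an operator norm estimate: an eigenvector \<open>v\<close> of X*
  X is a vector on which \<open>X\<close> scales the squared norm by exactly the eigenvalue.\<close>

lemma singular_value_square_le:
  assumes X: "X \<in> carrier_mat n n"
    and bound: "\<And>v. v \<in> carrier_vec n \<Longrightarrow>
      (\<Sum>i<n. (cmod ((X *\<^sub>v v) $ i))\<^sup>2) \<le> C * (\<Sum>i<n. (cmod (v $ i))\<^sup>2)"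
    and s: "s \<in> set (singular_values X)"
  shows "s\<^sup>2 \<le> C"
proof -
  let ?H = "mat_adjoint X * X"
  have H: "?H \<in> carrier_mat n n"
    using X by (auto simp: mat_adjoint_def mat_of_rows_def cols_def)
  then have "char_poly ?H \<noteq> 0"
    using degree_monic_char_poly[OF H] by auto
  then obtain e where e: "poly (char_poly ?H) e = 0" and s_eq: "s = sqrt (Re e)"
    using s by (auto simp: singular_values_def)
  then obtain v where v: "v \<in> carrier_vec n" "v \<noteq> 0\<^sub>v n" and eig: "?H *\<^sub>v v = e \<cdot>\<^sub>v v"
    using eigenvalue_root_char_poly[OF H, of e] H
    by (auto simp: eigenvalue_def eigenvector_def)
  define N where "N = (\<Sum>i<n. (cmod (v $ i))\<^sup>2)"
  define M where "M = (\<Sum>i<n. (cmod ((X *\<^sub>v v) $ i))\<^sup>2)"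
  obtain i where i: "i < n" "v $ i \<noteq> 0"
    using v by (metis carrier_vecD eq_vecI index_zero_vec)
  then have N: "N > 0" unfolding N_def by (intro sum_pos2[of _ i]) auto
  have "Re (e * complex_of_real N) = Re (complex_of_real M)"
    unfolding N_def M_def using eigenvalue_adjoint_mult[OF X v(1) eig] by simp
  then have eM: "Re e * N = M" by simp
  have "M \<ge> 0" by (auto simp: M_def intro: sum_nonneg)
  \<comment> \<open>Needed to identify \<open>s\<^sup>2\<close> with \<open>Re e\<close>: the real
    \<open>sqrt\<close> is odd, so a negative argument would give the absolute value
    instead.\<close>
  then have "Re e \<ge> 0" using eM N by (auto simp: zero_le_mult_iff)
  moreover have "Re e * N \<le> C * N"
    using bound[OF v(1)] eM by (simp add: N_def M_def)
  ultimately show ?thesis using N by (simp add: s_eq)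
qed

lemma sum_lessThan_mult:
  fixes g :: "nat \<Rightarrow> 'a::comm_monoid_add"
  shows "(\<Sum>c<m * n. g c) = (\<Sum>i<m. \<Sum>j<n. g (i * n + j))"
proof -
  have "(\<Sum>c<m * n. g c) = (\<Sum>i<m. sum g {i * n..<i * n + n})"
    by (simp add: sum.nat_group)
  also have "\<dots> = (\<Sum>i<m. \<Sum>j<n. g (i * n + j))"
    using sum.shift_bounds_nat_ivl[of g 0 _ n]
    by (simp add: atLeast0LessThan add.commute[of _ n] add.commute[of "_ * n"])
  finally show ?thesis .
qed

lemma monomial_mat_index:
  assumes "P = mat d d (\<lambda>(i, j). if j = p i then 1 else 0)" "i < d" "j < d"
  shows "(mat_diag d a * P) $$ (i, j) = (if j = p i then a i else (0::complex))"
  using assms by (auto simp: mat_diag_mult_left[of _ d d])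

text \<open>Rows \<open>i\<close>, \<open>i'\<close> and columns \<open>j\<close>, \<open>j'\<close>
  cut out a 2 by 2 block that is diagonal with nonzero diagonal, so columns \<open>j\<close> and
  \<open>j'\<close> are independent and the rank is at least 2.\<close>

lemma rank_one_nonzero_entries:
  fixes A :: "complex mat"
  assumes A: "A \<in> carrier_mat d d" and rank: "vec_space.rank d A = 1"
    and idx: "i < d" "i' < d" "j < d" "j' < d"
    and nz: "A $$ (i, j) \<noteq> 0" "A $$ (i', j') \<noteq> 0"
    and z: "A $$ (i, j') = 0" "A $$ (i', j) = 0"
  shows False
proof -
  interpret vec_space "TYPE(complex)" d .
  let ?u = "col A j" and ?v = "col A j'"
  have u: "?u \<in> carrier_vec d" and v: "?v \<in> carrier_vec d" using A by auto
  have ui: "?u $ i = A $$ (i, j)" "?v $ i = 0" "?u $ i' = 0" "?v $ i' = A $$ (i', j')"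
    using A idx z by auto
  have ne: "?u \<noteq> ?v" using ui nz by metis
  have "lin_indpt {?u, ?v}"
  proof (rule finite_lin_indpt2)
    fix c assume lc: "lincomb c {?u, ?v} = 0\<^sub>v d"
    have "c ?u * ?u $ r + c ?v * ?v $ r = 0" if "r < d" for r
      using lincomb_index[of r "{?u, ?v}" c] that lc u v ne by simp
    \<comment> \<open>Row \<open>i\<close> isolates the coefficient of \<open>?u\<close>, and row
      \<open>i'\<close> that of \<open>?v\<close>.\<close>
    from this[OF idx(1)] this[OF idx(2)] show "\<forall>x\<in>{?u, ?v}. c x = 0"
      unfolding ui using nz by simp
  qed (use u v in auto)
  moreover have "{?u, ?v} \<subseteq> set (cols A)" using A idx by (auto simp: cols_def)
  ultimately have "card {?u, ?v} \<le> rank A"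
    using rank_ge_card_indpt[OF A] by blast
  then show False using ne rank by simp
qed

lemma cmod_add_mult_square_le:
  "(cmod (x * u + y * w))\<^sup>2 \<le> ((cmod x)\<^sup>2 + (cmod y)\<^sup>2) * ((cmod u)\<^sup>2 + (cmod w)\<^sup>2)"
proof -
  have "cmod (x * u + y * w) \<le> cmod x * cmod u + cmod y * cmod w"
    by (metis norm_mult norm_triangle_ineq)
  then have "(cmod (x * u + y * w))\<^sup>2 \<le> (cmod x * cmod u + cmod y * cmod w)\<^sup>2"
    by (simp add: power_mono)
  also have "\<dots> \<le> ((cmod x)\<^sup>2 + (cmod y)\<^sup>2) * ((cmod u)\<^sup>2 + (cmod w)\<^sup>2)"
    \<comment> \<open>Lagrange's identity: this square is the difference of the two sides.\<close>
    using zero_le_power2[of "cmod x * cmod w - cmod y * cmod u"]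
    by (simp add: power2_eq_square algebra_simps)
  finally show ?thesis .
qed

text \<open>The norm estimate in coordinates, with \<open>i\<close> the block and \<open>j\<close>
  the position inside it. Blocks \<open>k\<close> and \<open>l\<close> are estimated jointly, since
  the excess in block \<open>k\<close> is absorbed by the slack in block \<open>l\<close>; each
  other block obeys the bound on its own.\<close>

lemma block_operator_bound:
  fixes f :: "nat \<Rightarrow> nat \<Rightarrow> complex" and b :: "nat \<Rightarrow> complex"
  assumes kl: "k < d" "l < d" "k \<noteq> l"
    and q: "q permutes {..<d}" "\<And>j. j < d \<Longrightarrow> q j \<noteq> j"
  shows "(\<Sum>i<d. \<Sum>j<d. (cmod ((if i = k then \<alpha> * f l j else 0) + b j * f i (q j)))\<^sup>2)
    \<le> ((cmod \<alpha>)\<^sup>2 + (\<Sum>j<d. (cmod (b j))\<^sup>2)) * (\<Sum>i<d. \<Sum>j<d. (cmod (f i j))\<^sup>2)"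
    (is "(\<Sum>i<d. ?G i) \<le> (?a + ?S) * _")
proof -
  define F where "F i = (\<Sum>j<d. (cmod (f i j))\<^sup>2)" for i
  have qd: "q j < d" if "j < d" for j
    using permutes_in_image[OF q(1)] that by auto
  have single: "(cmod (f i j))\<^sup>2 \<le> F i" if "j < d" for i j
    unfolding F_def using that by (intro member_le_sum) auto
  \<comment> \<open>As \<open>q\<close> has no fixed point, \<open>j\<close> and \<open>q j\<close>
    are two different positions, so both squares occur in \<open>F i\<close>.\<close>
  have pair: "(cmod (f i j))\<^sup>2 + (cmod (f i (q j)))\<^sup>2 \<le> F i" if "j < d" for i j
  proof -
    have "(\<Sum>j'\<in>{j, q j}. (cmod (f i j'))\<^sup>2) \<le> F i"
      unfolding F_def using that qd by (intro sum_mono2) auto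
    then show ?thesis using q(2)[OF that] by simp
  qed
  have F_q: "(\<Sum>j<d. (cmod (f i (q j)))\<^sup>2) = F i" for i
    unfolding F_def using sum.permute[OF q(1), of "\<lambda>j. (cmod (f i j))\<^sup>2"] by (simp add: o_def)
  have F0: "F i \<ge> 0" for i by (auto simp: F_def intro: sum_nonneg)
  have G: "?G i = (\<Sum>j<d. (cmod (b j))\<^sup>2 * (cmod (f i (q j)))\<^sup>2)" if "i \<noteq> k" for i
    using that by (simp add: norm_mult power_mult_distrib)
  have other: "?G i \<le> (?a + ?S) * F i" if "i \<noteq> k" for i
  proof -
    have "?G i \<le> (\<Sum>j<d. (cmod (b j))\<^sup>2 * F i)"
      unfolding G[OF that] by (intro sum_mono mult_left_mono single qd) auto
    also have "\<dots> \<le> (?a + ?S) * F i"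
      using F0[of i] by (simp add: sum_distrib_right[symmetric] distrib_right)
    finally show ?thesis .
  qed
  have "?G k \<le> (\<Sum>j<d. (?a + (cmod (b j))\<^sup>2) * ((cmod (f l j))\<^sup>2 + (cmod (f k (q j)))\<^sup>2))"
    using cmod_add_mult_square_le by (intro sum_mono) simp
  \<comment> \<open>The coefficient of \<open>?a\<close> is complete in both blocks: summing over
    \<open>q j\<close> instead of \<open>j\<close> still yields \<open>F k\<close>.\<close>
  also have "\<dots> = ?a * (F l + F k) + (\<Sum>j<d. (cmod (b j))\<^sup>2 * (cmod (f l j))\<^sup>2)
      + (\<Sum>j<d. (cmod (b j))\<^sup>2 * (cmod (f k (q j)))\<^sup>2)"
    by (simp add: F_q[symmetric, of k] F_def[of l] algebra_simps sum.distrib sum_distrib_left)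
  finally have "?G k + ?G l \<le> ?a * (F l + F k)
      + (\<Sum>j<d. (cmod (b j))\<^sup>2 * ((cmod (f l j))\<^sup>2 + (cmod (f l (q j)))\<^sup>2))
      + (\<Sum>j<d. (cmod (b j))\<^sup>2 * (cmod (f k (q j)))\<^sup>2)"
    using G[of l] kl by (simp add: algebra_simps sum.distrib)
  \<comment> \<open>\<open>pair\<close> handles block \<open>l\<close>, where two terms share the
    weight of \<open>b j\<close>; \<open>single\<close> suffices for block \<open>k\<close>.\<close>
  also have "\<dots> \<le> ?a * (F l + F k) + (\<Sum>j<d. (cmod (b j))\<^sup>2 * F l) + (\<Sum>j<d. (cmod (b j))\<^sup>2 * F k)"
    by (intro add_mono order_refl sum_mono mult_left_mono single pair qd) auto
  also have "\<dots> = (?a + ?S) * (F k + F l)"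
    by (simp add: algebra_simps sum_distrib_left)
  finally have main: "?G k + ?G l \<le> (?a + ?S) * (F k + F l)" .
  have split: "(\<Sum>i<d. h i) = h k + h l + (\<Sum>i\<in>{..<d} - {k, l}. h i)" for h :: "nat \<Rightarrow> real"
    using kl sum.subset_diff[of "{k, l}" "{..<d}" h] by simp
  have "(\<Sum>i<d. ?G i) \<le> (?a + ?S) * (F k + F l) + (\<Sum>i\<in>{..<d} - {k, l}. (?a + ?S) * F i)"
    unfolding split[of ?G] using main other by (intro add_mono sum_mono) auto
  also have "\<dots> = (?a + ?S) * (\<Sum>i<d. F i)"
    unfolding split[of F] by (simp add: distrib_left sum_distrib_left)
  finally show ?thesis by (simp add: F_def)
qed

text \<open>With the index written as \<open>i * n + j\<close>, the first summand mixes blocks at a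
  fixed position \<open>j\<close>, while the second acts by \<open>B\<close> inside block
  \<open>i\<close>.\<close>

lemma kronecker_sum_mult_vec_index:
  fixes A B :: "complex mat"
  assumes A: "A \<in> carrier_mat m m" and B: "B \<in> carrier_mat n n"
    and v: "v \<in> carrier_vec (m * n)" and ij: "i < m" "j < n"
  shows "((A \<otimes>\<^sub>K 1\<^sub>m n + 1\<^sub>m m \<otimes>\<^sub>K B) *\<^sub>v v) $ (i * n + j) =
    (\<Sum>i'<m. A $$ (i, i') * v $ (i' * n + j)) + (\<Sum>j'<n. B $$ (j, j') * v $ (i * n + j'))"
proof -
  let ?X = "A \<otimes>\<^sub>K 1\<^sub>m n + 1\<^sub>m m \<otimes>\<^sub>K B"
  have X: "?X \<in> carrier_mat (m * n) (m * n)"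
    using A B by (auto simp: kronecker_def)
  have lt: "i' * n + j' < m * n" if "i' < m" "j' < n" for i' j'
  proof -
    have "i' * n + j' < Suc i' * n" using that by simp
    also have "\<dots> \<le> m * n" using that by (intro mult_le_mono1) simp
    finally show ?thesis .
  qed
  have entry: "?X $$ (i * n + j, i' * n + j') =
      A $$ (i, i') * (if j = j' then 1 else 0) + (if i = i' then 1 else 0) * B $$ (j, j')"
    if "i' < m" "j' < n" for i' j'
    using that ij lt[OF that] lt[OF ij] A B by (auto simp: kronecker_def)
  have "(?X *\<^sub>v v) $ (i * n + j) = (\<Sum>c<m * n. ?X $$ (i * n + j, c) * v $ c)"
    using X v lt[OF ij]
    by (auto simp: scalar_prod_def atLeast0LessThan simp del: index_add_mat)
  also have "\<dots> = (\<Sum>i'<m. \<Sum>j'<n. ?X $$ (i * n + j, i' * n + j') * v $ (i' * n + j'))"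
    by (rule sum_lessThan_mult)
  also have "\<dots> = (\<Sum>i'<m. \<Sum>j'<n. (if j = j' then A $$ (i, i') * v $ (i' * n + j') else 0))
      + (\<Sum>i'<m. \<Sum>j'<n. (if i = i' then B $$ (j, j') * v $ (i' * n + j') else 0))"
    unfolding sum.distrib[symmetric] by (intro sum.cong refl) (auto simp: entry distrib_right)
  also have "(\<Sum>i'<m. \<Sum>j'<n. (if i = i' then B $$ (j, j') * v $ (i' * n + j') else 0))
      = (\<Sum>i'<m. if i = i' then \<Sum>j'<n. B $$ (j, j') * v $ (i' * n + j') else 0)"
    by (intro sum.cong) auto
  finally show ?thesis using ij by simp
qed

theorem lemma8:
  fixes d :: nat
    and a b :: "nat \<Rightarrow> complex"
    and D\<^sub>A D\<^sub>B P\<^sub>A P\<^sub>B A B X :: "complex mat"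
    and \<sigma> :: "real list"
  assumes "d \<ge> 4"
    and "D\<^sub>A = mat_diag d a" and "D\<^sub>B = mat_diag d b"
    and "permutation_mat d P\<^sub>A" and "\<forall>i<d. P\<^sub>A $$ (i, i) = 0"
    and "permutation_mat d P\<^sub>B" and "\<forall>i<d. P\<^sub>B $$ (i, i) = 0"
    and "A = D\<^sub>A * P\<^sub>A" and "B = D\<^sub>B * P\<^sub>B"
    and "(\<Sum>i<d. (cmod (a i))\<^sup>2 + (cmod (b i))\<^sup>2) = 1 / real d"
    and "vec_space.rank d A = 1"
    and "X = A \<otimes>\<^sub>K 1\<^sub>m d + 1\<^sub>m d \<otimes>\<^sub>K B"
    and "\<sigma> = singular_values X"
  shows "(\<sigma> ! 0)\<^sup>2 + (\<sigma> ! 1)\<^sup>2 \<le> 1 / 2"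
proof -
  obtain p where p: "p permutes {..<d}" and PA: "P\<^sub>A = mat d d (\<lambda>(i, j). if j = p i then 1 else 0)"
    using assms(4) by (auto simp: permutation_mat_def)
  obtain q where q: "q permutes {..<d}" and PB: "P\<^sub>B = mat d d (\<lambda>(i, j). if j = q i then 1 else 0)"
    using assms(6) by (auto simp: permutation_mat_def)
  have p_ne: "p i \<noteq> i" if "i < d" for i
    using assms(5) that by (auto simp: PA split: if_splits)
  have q_ne: "q i \<noteq> i" if "i < d" for i
    using assms(7) that by (auto simp: PB split: if_splits)
  have p_lt: "p i < d" if "i < d" for i using permutes_in_image[OF p] that by auto
  have q_lt: "q i < d" if "i < d" for i using permutes_in_image[OF q] that by auto
  have A: "A \<in> carrier_mat d d" and B: "B \<in> carrier_mat d d"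
    by (auto simp: assms(2,3,8,9) PA PB mat_diag_def)
  have A_nth: "A $$ (i, j) = (if j = p i then a i else 0)" if "i < d" "j < d" for i j
    using monomial_mat_index[OF PA that] by (simp add: assms(2,8))
  have B_nth: "B $$ (i, j) = (if j = q i then b i else 0)" if "i < d" "j < d" for i j
    using monomial_mat_index[OF PB that] by (simp add: assms(3,9))
  \<comment> \<open>Since \<open>p\<close> is injective, rows \<open>i\<close> and \<open>i'\<close>
    of \<open>A\<close> have their possible nonzero entries in different columns, so two nonzero
    weights would contradict rank one.\<close>
  have "a i = 0 \<or> a i' = 0" if "i < d" "i' < d" "i \<noteq> i'" for i i'
  proof (rule ccontr)
    assume nz: "\<not> (a i = 0 \<or> a i' = 0)"
    have "p i \<noteq> p i'" using permutes_inj[OF p] that by (auto dest: injD)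
    then show False
      using rank_one_nonzero_entries[OF A assms(11) that(1,2) p_lt[OF that(1)] p_lt[OF that(2)]]
        that nz p_lt by (auto simp: A_nth)
  qed
  then obtain k where k: "k < d" and a0: "\<And>i. i < d \<Longrightarrow> i \<noteq> k \<Longrightarrow> a i = 0"
    using assms(1) by (metis less_le_trans zero_less_numeral)
  have norm_sum: "(cmod (a k))\<^sup>2 + (\<Sum>j<d. (cmod (b j))\<^sup>2) = 1 / real d"
  proof -
    have "(\<Sum>i<d. (cmod (a i))\<^sup>2) = (\<Sum>i<d. if i = k then (cmod (a k))\<^sup>2 else 0)"
      using a0 by (intro sum.cong) auto
    then show ?thesis using assms(10) k by (simp add: sum.distrib)
  qed
  have X: "X \<in> carrier_mat (d * d) (d * d)"
    using A B by (auto simp: assms(12) kronecker_def)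
  have bound: "(\<Sum>r<d * d. (cmod ((X *\<^sub>v v) $ r))\<^sup>2) \<le> 1 / real d * (\<Sum>r<d * d. (cmod (v $ r))\<^sup>2)"
    if v: "v \<in> carrier_vec (d * d)" for v
  proof -
    define f where "f i j = v $ (i * d + j)" for i j
    have Xv: "(X *\<^sub>v v) $ (i * d + j) = (if i = k then a k * f (p k) j else 0) + b j * f i (q j)"
      if "i < d" "j < d" for i j
    proof -
      have "(\<Sum>i'<d. A $$ (i, i') * v $ (i' * d + j)) = (\<Sum>i'<d. if i' = p i then a i * f (p i) j else 0)"
        using that by (intro sum.cong) (auto simp: A_nth f_def)
      moreover have "(\<Sum>j'<d. B $$ (j, j') * v $ (i * d + j')) = (\<Sum>j'<d. if j' = q j then b j * f i (q j) else 0)"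
        using that by (intro sum.cong) (auto simp: B_nth f_def)
      ultimately show ?thesis
        using that a0[of i] p_lt q_lt
        by (auto simp: assms(12) kronecker_sum_mult_vec_index[OF A B v])
    qed
    have "(\<Sum>r<d * d. (cmod ((X *\<^sub>v v) $ r))\<^sup>2) =
        (\<Sum>i<d. \<Sum>j<d. (cmod ((if i = k then a k * f (p k) j else 0) + b j * f i (q j)))\<^sup>2)"
      by (simp add: sum_lessThan_mult Xv cong: sum.cong_simp)
    also have "\<dots> \<le> 1 / real d * (\<Sum>i<d. \<Sum>j<d. (cmod (f i j))\<^sup>2)"
      \<comment> \<open>The block feeding into block \<open>k\<close> is \<open>l = p k\<close>,
        which differs from \<open>k\<close> because \<open>P\<^sub>A\<close> has zero
        diagonal.\<close>
      using block_operator_bound[OF k p_lt[OF k] p_ne[OF k, symmetric] q q_ne, of "a k" f b]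
      by (simp only: norm_sum)
    finally show ?thesis by (simp add: sum_lessThan_mult f_def)
  qed
  have "2 \<le> d * d" using assms(1) mult_le_mono[of 4 d 4 d] by simp
  then have "\<sigma> ! 0 \<in> set \<sigma>" "\<sigma> ! 1 \<in> set \<sigma>"
    using length_singular_values[OF X] by (auto simp: assms(13) intro!: nth_mem)
  then have "(\<sigma> ! 0)\<^sup>2 \<le> 1 / real d" "(\<sigma> ! 1)\<^sup>2 \<le> 1 / real d"
    using singular_value_square_le[OF X bound] by (auto simp: assms(13))
  \<comment> \<open>Here \<open>d \<ge> 4\<close> produces the constant: each of the two squares is
    at most 1/4.\<close>
  moreover have "1 / real d \<le> 1 / 4"
    using assms(1) by (intro divide_left_mono) auto
  ultimately show ?thesis by linarith
qed

end
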